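(* Let $c_1>0$, $c_2\ge 0$, $\boldsymbol{x}_0\in\mathbb{R}^2$, and let $$\mathbf{F}^{(S)}(\zeta,\xi)=(c_1\xi+c_2)\,(\gamma^{(S)}(\zeta)-\boldsymbol{x}_0)+\boldsymbol{x}_0,\qquad S\in\{L,R\},$$ be a two-patch scaled boundary parametrization with boundary curves $\gamma^{(L)},\gamma^{(R)}$ satisfying the standing assumptions listed in the context. If $c_2>0$, then the two-patch parametrization is analysis-suitable $G^1$. If $c_2=0$, then it is analysis-suitable $G^1$ except at the scaling center $\boldsymbol{x}_0$. In other words, in both cases there exist polynomial functions $\alpha^{(L)},\alpha^{(R)},\beta^{(L)},\beta^{(R)}:[0,1]\to\mathbb{R}$ of degree at most $1$ such that, with $\beta:=\alpha^{(L)}\beta^{(R)}-\alpha^{(R)}\beta^{(L)}$, for all $\xi\in[0,1]$, $$\alpha^{(L)}(\xi)\,\alpha^{(R)}(\xi)>0,$$ $$\alpha^{(R)}(\xi)\,\partial_\zeta\mathbf{F}^{(L)}(0,\xi)-\alpha^{(L)}(\xi)\,\partial_\zeta\mathbf{F}^{(R)}(0,\xi)+\beta(\xi)\,\partial_\xi\mathbf{F}^{(R)}(0,\xi)=\mathbf{0}.$$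
   Context: Parametric domains: $\widehat\Omega^{(L)}=(-1,0)\times(0,1)$ and $\widehat\Omega^{(R)}=(0,1)\times(0,1)$, with coordinates $(\zeta,\xi)$. Patches: $\Omega^{(S)}=\mathbf{F}^{(S)}(\widehat\Omega^{(S)})$, $S\in\{L,R\}$. The boundary curves are $\gamma^{(L)}:[-1,0]\to\mathbb{R}^2$ and $\gamma^{(R)}:[0,1]\to\mathbb{R}^2$. The interface is $\Gamma=\mathbf{F}^{(L)}(\{0\}\times[0,1])=\mathbf{F}^{(R)}(\{0\}\times[0,1])$. Standing assumptions: (i) $\gamma^{(L)},\gamma^{(R)}$ are $C^1$ (one-sided derivatives at end points), $\gamma^{(L)}(0)=\gamma^{(R)}(0)$, $\partial_\zeta\gamma^{(L)}(0)\neq\boldsymbol 0$, $\partial_\zeta\gamma^{(R)}(0)\neq\boldsymbol 0$. (ii) For every $\delta\in(0,1)$ and $S\in\{L,R\}$, the restriction of $\mathbf{F}^{(S)}$ to $\widehat\Omega^{(S)}\cap\{\xi>\delta\}$ is $C^1$ up to the closure and defines a $C^1$-diffeomorphism up to the closure (injective, with invertible Jacobian matrix on the closed set). (iii) The patches do not overlap: $\Omega^{(L)}\cap\Omega^{(R)}=\emptyset$ (they lie on the two different sides of the interface $\Gamma$). A two-patch parametrization is called analysis-suitable $G^1$ (AS-$G^1$) if polynomials $\alpha^{(S)},\beta^{(S)}$ of degree at most $1$ as in the displayed condition of the claim exist. For $c_2=0$ the maps $\mathbf{F}^{(S)}$ are singular along $\xi=0$ (the whole edge is mapped to $\boldsymbol{x}_0$);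 "AS-$G^1$ except at the scaling center" means that the displayed condition holds although the maps $\mathbf{F}^{(S)}$ are regular only away from $\xi=0$. *)

theory Defs
  imports "HOL-Analysis.Analysis" "HOL-Computational_Algebra.Polynomial"
begin

text \<open>
  Points of the parametric plane are vectors \<open>p :: real ^ 2\<close> with coordinates
  \<open>\<zeta> = p $ 1\<close> and \<open>\<xi> = p $ 2\<close>.
\<close>

definition dom_L :: "(real ^ 2) set" where
  "dom_L = {p. -1 < p $ 1 \<and> p $ 1 < 0 \<and> 0 < p $ 2 \<and> p $ 2 < 1}"

definition dom_R :: "(real ^ 2) set" where
  "dom_R = {p. 0 < p $ 1 \<and> p $ 1 < 1 \<and> 0 < p $ 2 \<and> p $ 2 < 1}"

definition scaled_boundary ::
    "real \<Rightarrow> real \<Rightarrow> real ^ 2 \<Rightarrow> (real \<Rightarrow> real ^ 2) \<Rightarrow> real ^ 2 \<Rightarrow> real ^ 2" where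
  "scaled_boundary c1 c2 x0 \<gamma> p = (c1 * p $ 2 + c2) *\<^sub>R (\<gamma> (p $ 1) - x0) + x0"

text \<open>
  The library's \<open>C1_differentiable_on\<close> asks for two-sided derivatives at every point of the set.
  Here derivatives are taken within \<open>S\<close>, so they are one-sided at boundary points and do not
  depend on the values of \<open>f\<close> outside \<open>S\<close>. The sets used are nondegenerate closed intervals and
  rectangles, on which such derivatives are unique.
\<close>

definition C1_on :: "('a::real_normed_vector \<Rightarrow> 'b::real_normed_vector) \<Rightarrow> 'a set \<Rightarrow> bool" where
  "C1_on f S \<longleftrightarrow>
     (\<exists>f' :: 'a \<Rightarrow> ('a \<Rightarrow>\<^sub>L 'b).
        (\<forall>x\<in>S. (f has_derivative blinfun_apply (f' x)) (at x within S)) \<and> continuous_on S f')"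

definition C1_diffeo_up_to_closure :: "(real ^ 2 \<Rightarrow> real ^ 2) \<Rightarrow> (real ^ 2) set \<Rightarrow> bool" where
  "C1_diffeo_up_to_closure F U \<longleftrightarrow>
     C1_on F (closure U) \<and> inj_on F (closure U) \<and>
     (\<forall>p\<in>closure U. invertible (jacobian F (at p within closure U)))"

text \<open>
  Gluing condition along \<open>\<zeta> = 0\<close>; \<open>F\<^sub>L\<close> lives on \<open>[-1,0] \<times> [0,1]\<close> and \<open>F\<^sub>R\<close> on \<open>[0,1] \<times> [0,1]\<close>, so
  the \<open>\<zeta>\<close>-derivatives at the interface are one-sided. No regularity of the maps is part of the
  definition: it also applies when they degenerate at \<open>\<xi> = 0\<close>, where it is the notion of
  being analysis-suitable \<open>G\<^sup>1\<close> except at the scaling center.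
\<close>

definition analysis_suitable_G1 ::
    "(real ^ 2 \<Rightarrow> real ^ 2) \<Rightarrow> (real ^ 2 \<Rightarrow> real ^ 2) \<Rightarrow> bool" where
  "analysis_suitable_G1 FL FR \<longleftrightarrow>
     (\<exists>\<alpha>L \<alpha>R \<beta>L \<beta>R :: real poly.
        degree \<alpha>L \<le> 1 \<and> degree \<alpha>R \<le> 1 \<and> degree \<beta>L \<le> 1 \<and> degree \<beta>R \<le> 1 \<and>
        (let \<beta> = \<alpha>L * \<beta>R - \<alpha>R * \<beta>L in
          \<forall>\<xi>\<in>{0..1}.
            poly \<alpha>L \<xi> * poly \<alpha>R \<xi> > 0 \<and>
            poly \<alpha>R \<xi> *\<^sub>R vector_derivative (\<lambda>\<zeta>. FL (vector [\<zeta>, \<xi>])) (at 0 within {-1..0})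
            - poly \<alpha>L \<xi> *\<^sub>R vector_derivative (\<lambda>\<zeta>. FR (vector [\<zeta>, \<xi>])) (at 0 within {0..1})
            + poly \<beta> \<xi> *\<^sub>R vector_derivative (\<lambda>\<eta>. FR (vector [0, \<eta>])) (at \<xi> within {0..1})
            = 0))"

end

theory Submission
  imports Defs
begin

text \<open>
  Write \<open>g = \<gamma>(0) - x\<^sub>0\<close>, and \<open>a\<close>, \<open>b\<close> for the one-sided derivatives of the two boundary curves
  at \<open>0\<close>. At the interface the partial derivatives are \<open>(c\<^sub>1 \<xi> + c\<^sub>2) a\<close>, \<open>(c\<^sub>1 \<xi> + c\<^sub>2) b\<close> and
  \<open>c\<^sub>1 g\<close>. Regularity makes \<open>det (g, a)\<close> and \<open>det (g, b)\<close> nonzero; they serve as constant \<open>\<alpha>\<close>'s,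
  because \<open>det (g, b) a - det (g, a) b\<close> is a multiple of \<open>g\<close> and can be balanced by a \<open>\<beta>\<close>
  proportional to \<open>c\<^sub>1 \<xi> + c\<^sub>2\<close>. If the determinants had opposite signs, both patches would leave
  the interface on the same side: by the intermediate value theorem some ray from \<open>x\<^sub>0\<close> close to
  \<open>g\<close> would meet both curves, at almost equal distances, and the patches would share a point of
  that ray.
\<close>

section \<open>The planar determinant and parallel vectors\<close>

definition det2 :: "real ^ 2 \<Rightarrow> real ^ 2 \<Rightarrow> real" where
  "det2 u v = u $ 1 * v $ 2 - u $ 2 * v $ 1"

lemma bounded_linear_det2: "bounded_linear (det2 g)"
proof -
  have "det2 g = (\<lambda>v. vector [- g $ 2, g $ 1] \<bullet> v)"
    by (auto simp: det2_def inner_vec_def sum_2 fun_eq_iff)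
  then show ?thesis
    by (simp add: bounded_linear_inner_right)
qed

lemma det2_self [simp]: "det2 g g = 0"
  by (simp add: det2_def)

text \<open>Expansion of \<open>v\<close> in the orthogonal pair formed by \<open>g\<close> and its
  quarter-turn rotation. The factor \<open>g \<bullet> g\<close> clears denominators, so the case
  \<open>g = 0\<close> needs no separate treatment.\<close>

lemma det2_decomposition:
  "(g \<bullet> g) *\<^sub>R v = (g \<bullet> v) *\<^sub>R g + det2 g v *\<^sub>R vector [- g $ 2, g $ 1]"
  by (simp add: vec_eq_iff forall_2 inner_vec_def sum_2 det2_def algebra_simps)

lemma det2_eq_0_imp_parallel:
  assumes "det2 g v = 0"
  shows "(g \<bullet> g) *\<^sub>R v = (g \<bullet> v) *\<^sub>R g"
  using det2_decomposition[of g v] assms by simp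

section \<open>Curves leaving a point towards the same side\<close>

lemma IVT_eventually_at_right:
  fixes f :: "real \<Rightarrow> real"
  assumes "continuous_on {0..d} f" "f 0 = 0" "0 < d" "f d > 0"
  shows "eventually (\<lambda>e. \<exists>t\<in>{0<..<d}. f t = e) (at_right 0)"
proof -
  have "\<exists>t\<in>{0<..<d}. f t = e" if e: "0 < e" "e < f d" for e
  proof -
    obtain t where t: "0 \<le> t" "t \<le> d" "f t = e"
      using IVT'[of f 0 e d] assms e by auto
    moreover have "t \<noteq> 0" "t \<noteq> d"
      using t e assms by auto
    ultimately show ?thesis by force
  qed
  then show ?thesis
    unfolding eventually_at_right_field using assms(4) by blast
qed

text \<open>The quotient of \<open>k * det2 (v 0) (v t)\<close> by \<open>v 0 \<bullet> v t\<close>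
  is, up to the factor \<open>k\<close>, the slope of \<open>v t\<close> relative to the direction
  \<open>v 0\<close>. It vanishes at \<open>t = 0\<close> and is positive just afterwards, since the
  numerator has a positive derivative there, so it takes every small positive value. The bound on
  \<open>h\<close> keeps the denominator positive. Phrased with a filter, the result can be applied
  to two curves with one common slope \<open>e\<close>.\<close>

lemma curve_attains_small_slopes:
  fixes v :: "real \<Rightarrow> real ^ 2"
  assumes cont: "continuous_on {0..1} v"
    and der: "(v has_vector_derivative d) (at 0 within {0..1})"
    and pos: "k * det2 (v 0) d > 0"
    and h: "0 < h" "h \<le> v 0 \<bullet> v 0"
  shows "eventually (\<lambda>e. \<exists>t\<in>{0<..<1}. \<bar>v 0 \<bullet> v t - v 0 \<bullet> v 0\<bar> < h \<and>
           k * det2 (v 0) (v t) = e * (v 0 \<bullet> v t)) (at_right 0)"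
proof -
  let ?p = "\<lambda>t. v 0 \<bullet> v t" and ?q = "\<lambda>t. k * det2 (v 0) (v t)"
  have contp: "continuous_on {0..1} ?p"
    by (intro continuous_intros cont)
  have contq: "continuous_on {0..1} ?q"
    by (intro continuous_intros bounded_linear.continuous_on[OF bounded_linear_det2] cont)
  have "(?q has_vector_derivative k * det2 (v 0) d) (at 0 within {0..1})"
    using bounded_linear.has_vector_derivative[OF bounded_linear_const_mult
        [OF bounded_linear_det2] der] by simp
  then have "(?q has_real_derivative k * det2 (v 0) d) (at 0 within {0..1})"
    by (simp add: has_real_derivative_iff_has_vector_derivative)
  from has_real_derivative_pos_inc_right[OF this pos]
  obtain d1 where d1: "d1 > 0" "\<And>t. 0 < t \<Longrightarrow> t \<le> 1 \<Longrightarrow> t < d1 \<Longrightarrow> ?q t > 0"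
    by auto
  have "(0::real) \<in> {0..1}"
    by simp
  from continuous_on_iff[THEN iffD1, OF contp, rule_format, OF this h(1)]
  obtain d2 where d2: "d2 > 0"
    "\<And>t. t \<in> {0..1} \<Longrightarrow> dist t 0 < d2 \<Longrightarrow> dist (?p t) (?p 0) < h"
    by blast
  define s where "s = min 1 (min d1 d2) / 2"
  have s: "0 < s" "s < 1" "s < d1" "s < d2"
    using d1(1) d2(1) by (auto simp: s_def)
  have near: "\<bar>?p t - ?p 0\<bar> < h" if "t \<in> {0..s}" for t
    using d2(2)[of t] s that by (simp add: dist_real_def)
  have ppos: "?p t > 0" if "t \<in> {0..s}" for t
    using near[OF that] h by linarith
  have "eventually (\<lambda>e. \<exists>t\<in>{0<..<s}. ?q t / ?p t = e) (at_right 0)"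
  proof (rule IVT_eventually_at_right)
    show "continuous_on {0..s} (\<lambda>t. ?q t / ?p t)"
      using s ppos
      by (intro continuous_on_divide continuous_on_subset[OF contq] continuous_on_subset[OF contp])
         fastforce+
    show "?q s / ?p s > 0"
      using d1(2)[of s] ppos[of s] s by simp
  qed (use s in auto)
  then show ?thesis
  proof eventually_elim
    case (elim e)
    then obtain t where t: "0 < t" "t < s" "?q t / ?p t = e"
      by auto
    then show ?case
      using near[of t] ppos[of t] s by (intro bexI[of _ t]) (auto simp: field_simps)
  qed
qed

text \<open>Both curves attain one common small slope \<open>e\<close>, so the inner products with
  \<open>g\<close> and the determinants against \<open>g\<close> are in the same ratio for the two
  points; by \<open>det2_decomposition\<close> the points are then proportional. The factor
  \<open>l\<close> is a quotient of two inner products that are both close to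
  \<open>g \<bullet> g\<close>, hence close to 1.\<close>

lemma curves_meet_common_ray:
  fixes v w :: "real \<Rightarrow> real ^ 2"
  assumes v: "continuous_on {0..1} v" "(v has_vector_derivative a) (at 0 within {0..1})"
    and w: "continuous_on {0..1} w" "(w has_vector_derivative b) (at 0 within {0..1})"
    and start: "v 0 = g" "w 0 = g"
    and side: "det2 g a * det2 g b > 0"
    and "\<epsilon> > 0"
  obtains s t l where "s \<in> {0<..<1}" "t \<in> {0<..<1}" "\<bar>l - 1\<bar> < \<epsilon>" "v s = l *\<^sub>R w t"
proof -
  \<comment> \<open>Multiplying by \<open>det2 g a\<close> makes both determinants positive,
    whichever sign they share.\<close>
  define k where "k = det2 g a"
  define G where "G = g \<bullet> g"
  have k: "k \<noteq> 0" "k * det2 g a > 0" "k * det2 g b > 0"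
    using side by (auto simp: k_def zero_less_mult_iff)
  have "g \<noteq> 0"
    using k by (auto simp: k_def det2_def)
  then have G: "G > 0"
    by (simp add: G_def)
  \<comment> \<open>The first bound forces \<open>g \<bullet> w t > G / 2\<close>; the second makes
    the two inner products differ by less than \<open>2 * h \<le> \<epsilon> * G / 2\<close>.
    Together they give a relative error below \<open>\<epsilon>\<close>.\<close>
  define h where "h = min (G / 2) (\<epsilon> * G / 4)"
  have h: "0 < h" "h \<le> G / 2" "h \<le> \<epsilon> * G / 4" "h \<le> G"
    using G \<open>\<epsilon> > 0\<close> by (auto simp: h_def)
  have "eventually (\<lambda>e.
      (\<exists>s\<in>{0<..<1}. \<bar>g \<bullet> v s - G\<bar> < h \<and> k * det2 g (v s) = e * (g \<bullet> v s)) \<and>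
      (\<exists>t\<in>{0<..<1}. \<bar>g \<bullet> w t - G\<bar> < h \<and> k * det2 g (w t) = e * (g \<bullet> w t))) (at_right 0)"
    using curve_attains_small_slopes[OF v, of k h] curve_attains_small_slopes[OF w, of k h]
      start k h by (intro eventually_conj) (simp_all add: G_def)
  then obtain e s t where st: "s \<in> {0<..<1}" "t \<in> {0<..<1}"
    and s: "\<bar>g \<bullet> v s - G\<bar> < h" "k * det2 g (v s) = e * (g \<bullet> v s)"
    and t: "\<bar>g \<bullet> w t - G\<bar> < h" "k * det2 g (w t) = e * (g \<bullet> w t)"
    using eventually_happens'[OF trivial_limit_at_right_real] by blast
  define l where "l = (g \<bullet> v s) / (g \<bullet> w t)"
  have p: "g \<bullet> w t > G / 2"
    using t(1) h by linarith
  then have p0: "g \<bullet> w t > 0"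
    using G by linarith
  have "\<bar>g \<bullet> v s - g \<bullet> w t\<bar> < \<epsilon> * (G / 2)"
    using s(1) t(1) h by linarith
  also have "\<dots> < \<epsilon> * (g \<bullet> w t)"
    using p \<open>\<epsilon> > 0\<close> by simp
  finally have "\<bar>l - 1\<bar> < \<epsilon>"
    using p0 by (simp add: l_def abs_less_iff field_simps)
  moreover have "v s = l *\<^sub>R w t"
  proof -
    have inner: "g \<bullet> v s = l * (g \<bullet> w t)"
      using p0 by (simp add: l_def)
    moreover have "det2 g (v s) = l * det2 g (w t)"
    proof -
      have "k * det2 g (v s) = k * (l * det2 g (w t))"
        using s(2) t(2) inner by (metis mult.left_commute)
      then show ?thesis using k by simp
    qed
    ultimately have "G *\<^sub>R v s = l *\<^sub>R (G *\<^sub>R w t)"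
      unfolding G_def det2_decomposition[of g "v s"] det2_decomposition[of g "w t"]
      by (simp add: scaleR_add_right)
    then have "G *\<^sub>R v s = G *\<^sub>R (l *\<^sub>R w t)"
      by (simp add: mult.commute)
    then show ?thesis
      using G by (simp only: scaleR_cancel_left) simp
  qed
  ultimately show thesis
    using that st by blast
qed

section \<open>One-sided derivatives and closed rectangles\<close>

lemma C1_on_has_vector_derivative:
  fixes f :: "real \<Rightarrow> 'b::real_normed_vector"
  assumes "C1_on f S" "x \<in> S"
  shows "(f has_vector_derivative vector_derivative f (at x within S)) (at x within S)"
  using assms
  by (auto simp: C1_on_def differentiable_def simp flip: vector_derivative_works)

lemma C1_on_imp_continuous_on:
  assumes "C1_on f S"
  shows "continuous_on S f"
  using assms unfolding C1_on_def
  by (meson continuous_on_eq_continuous_within has_derivative_continuous)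

lemma closure_open_rectangle:
  fixes a b c d :: real
  assumes "a < b" "c < d"
  shows "closure {p :: real ^ 2. a < p $ 1 \<and> p $ 1 < b \<and> c < p $ 2 \<and> p $ 2 < d} =
    {p. a \<le> p $ 1 \<and> p $ 1 \<le> b \<and> c \<le> p $ 2 \<and> p $ 2 \<le> d}"
proof -
  have "{p :: real ^ 2. a < p $ 1 \<and> p $ 1 < b \<and> c < p $ 2 \<and> p $ 2 < d} =
      box (vector [a, c]) (vector [b, d])"
    by (auto simp: mem_box_cart forall_2)
  moreover have "box (vector [a, c]) (vector [b, d] :: real ^ 2) \<noteq> {}"
    using assms by (auto simp: interval_ne_empty_cart forall_2)
  moreover have "cbox (vector [a, c]) (vector [b, d]) =
      {p :: real ^ 2. a \<le> p $ 1 \<and> p $ 1 \<le> b \<and> c \<le> p $ 2 \<and> p $ 2 \<le> d}"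
    by (auto simp: mem_box_cart forall_2)
  ultimately show ?thesis
    by (simp add: closure_box)
qed

lemma has_vector_derivative_vector_2_fst:
  "((\<lambda>z. vector [z, y] :: real ^ 2) has_vector_derivative axis 1 1) F"
proof -
  have "(\<lambda>z. vector [z, y] :: real ^ 2) = (\<lambda>z. z *\<^sub>R axis 1 1 + y *\<^sub>R axis 2 1)"
    by (auto simp: fun_eq_iff vec_eq_iff forall_2 axis_def)
  then show ?thesis
    by (auto intro!: derivative_eq_intros simp: has_vector_derivative_def)
qed

lemma has_vector_derivative_vector_2_snd:
  "((\<lambda>y. vector [z, y] :: real ^ 2) has_vector_derivative axis 2 1) F"
proof -
  have "(\<lambda>y. vector [z, y] :: real ^ 2) = (\<lambda>y. z *\<^sub>R axis 1 1 + y *\<^sub>R axis 2 1)"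
    by (auto simp: fun_eq_iff vec_eq_iff forall_2 axis_def)
  then show ?thesis
    by (auto intro!: derivative_eq_intros simp: has_vector_derivative_def)
qed

section \<open>Scaled boundary maps: partial derivatives, regularity, disjointness\<close>

lemma scaled_boundary_vector:
  "scaled_boundary c1 c2 x0 \<gamma> (vector [z, y]) = (c1 * y + c2) *\<^sub>R (\<gamma> z - x0) + x0"
  by (simp add: scaled_boundary_def)

lemma has_vector_derivative_scaled_boundary_fst:
  assumes "(\<gamma> has_vector_derivative a) (at z within S)"
  shows "((\<lambda>z. scaled_boundary c1 c2 x0 \<gamma> (vector [z, y]))
    has_vector_derivative (c1 * y + c2) *\<^sub>R a) (at z within S)"
  using assms unfolding scaled_boundary_vector has_vector_derivative_def
  by (auto intro!: derivative_eq_intros simp: algebra_simps)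

lemma has_vector_derivative_scaled_boundary_snd:
  "((\<lambda>y. scaled_boundary c1 c2 x0 \<gamma> (vector [z, y]))
    has_vector_derivative c1 *\<^sub>R (\<gamma> z - x0)) F"
  unfolding scaled_boundary_vector has_vector_derivative_def
  by (auto intro!: derivative_eq_intros simp: algebra_simps)

text \<open>At the point of height \<open>n\<close> on the top edge, the Jacobian sends the
  coordinate directions to \<open>(c1 * n + c2) *\<^sub>R a\<close> and to \<open>c1\<close> times
  \<open>\<gamma> z - x0\<close>. If \<open>a\<close> were parallel to
  \<open>\<gamma> z - x0\<close>, some nonzero vector would lie in its kernel.\<close>

lemma regular_scaled_boundary_det2_nonzero:
  fixes \<gamma> :: "real \<Rightarrow> real ^ 2"
  assumes reg: "C1_diffeo_up_to_closure (scaled_boundary c1 c2 x0 \<gamma>) U"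
    and cl: "closure U = {p. l \<le> p $ 1 \<and> p $ 1 \<le> r \<and> m \<le> p $ 2 \<and> p $ 2 \<le> n}"
    and "l \<le> z" "z \<le> r" "m < n" "l < r"
    and der: "(\<gamma> has_vector_derivative a) (at z within {l..r})"
    and c: "c1 \<noteq> 0" "c1 * n + c2 \<noteq> 0"
  shows "det2 (\<gamma> z - x0) a \<noteq> 0"
proof
  let ?F = "scaled_boundary c1 c2 x0 \<gamma>" and ?g = "\<gamma> z - x0" and ?p = "vector [z, n] :: real ^ 2"
  define D where "D = frechet_derivative ?F (at ?p within closure U)"
  have p: "?p \<in> closure U"
    using assms by (simp add: cl)
  then have F: "(?F has_derivative D) (at ?p within closure U)"
    using reg unfolding C1_diffeo_up_to_closure_def C1_on_def D_def
    by (metis differentiableI frechet_derivative_works)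
  then have lin: "linear D"
    by (rule has_derivative_linear)
  have inv: "invertible (matrix D)"
    using reg p by (simp add: C1_diffeo_up_to_closure_def jacobian_def D_def)
  have inj: "inj D"
    using inv lin
    by (metis inj_matrix_vector_mult matrix_works matrix_vector_mul(2))
  \<comment> \<open>The derivative within the rectangle restricts to the horizontal segment through
    the point. Uniqueness of derivatives on a nondegenerate interval identifies the result with the
    explicit partial derivative; \<open>D2\<close> is the same on the vertical segment.\<close>
  have D1: "D (axis 1 1) = (c1 * n + c2) *\<^sub>R a"
  proof (rule vector_derivative_unique_within_closed_interval[of l r z])
    show "((\<lambda>z. ?F (vector [z, n])) has_vector_derivative D (axis 1 1)) (at z within cbox l r)"
    proof -
      have "(?F has_derivative D) (at ?p within (\<lambda>z. vector [z, n]) ` {l..r})"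
        by (rule has_derivative_subset[OF F]) (use assms in \<open>auto simp: cl\<close>)
      from vector_derivative_diff_chain_within
        [OF has_vector_derivative_vector_2_fst this]
      show ?thesis by (simp add: o_def)
    qed
  qed (use assms has_vector_derivative_scaled_boundary_fst[OF der] in auto)
  have D2: "D (axis 2 1) = c1 *\<^sub>R ?g"
  proof (rule vector_derivative_unique_within_closed_interval[of m n n])
    show "((\<lambda>y. ?F (vector [z, y])) has_vector_derivative D (axis 2 1)) (at n within cbox m n)"
    proof -
      have "(?F has_derivative D) (at ?p within (\<lambda>y. vector [z, y]) ` {m..n})"
        by (rule has_derivative_subset[OF F]) (use assms in \<open>auto simp: cl\<close>)
      from vector_derivative_diff_chain_within
        [OF has_vector_derivative_vector_2_snd this]
      show ?thesis by (simp add: o_def)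
    qed
  qed (use assms has_vector_derivative_scaled_boundary_snd in auto)
  have D0: "D v = 0 \<Longrightarrow> v = 0" for v
    using inj lin linear_injective_0 by blast
  have g: "?g \<noteq> 0"
    using D0[of "axis 2 1"] D2 by (auto simp: axis_eq_0_iff)
  assume "det2 ?g a = 0"
  then have par: "(?g \<bullet> ?g) *\<^sub>R a = (?g \<bullet> a) *\<^sub>R ?g"
    by (rule det2_eq_0_imp_parallel)
  \<comment> \<open>The coefficients turn \<open>D v\<close> into a multiple of the combination of
    \<open>a\<close> and \<open>?g\<close> that vanishes by \<open>par\<close>, while the first
    coordinate \<open>c1 * (?g \<bullet> ?g)\<close> is nonzero.\<close>
  define v :: "real ^ 2" where
    "v = (c1 * (?g \<bullet> ?g)) *\<^sub>R axis 1 1 - ((c1 * n + c2) * (?g \<bullet> a)) *\<^sub>R axis 2 1"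
  have "D v = (c1 * (c1 * n + c2)) *\<^sub>R ((?g \<bullet> ?g) *\<^sub>R a - (?g \<bullet> a) *\<^sub>R ?g)"
    using lin by (simp add: v_def linear_diff linear_scale D1 D2 scaleR_diff_right mult.commute
        mult.left_commute)
  also have "\<dots> = 0"
    by (simp only: par diff_self scaleR_zero_right)
  finally have "v = 0"
    by (rule D0)
  then have "v $ 1 = 0" by simp
  then have "c1 * (?g \<bullet> ?g) = 0"
    by (simp add: v_def axis_def)
  then show False
    using c g by simp
qed

text \<open>Running the left curve backwards negates its derivative, so a negative product would
  make both curves leave the interface towards the same side. They would then meet a common ray from
  \<open>x0\<close>, and a suitable choice of heights \<xi> compensates the ratio \<open>l\<close>
  of the two distances, giving a point in both open patches.\<close>

lemma disjoint_patches_det2: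
  fixes \<gamma>L \<gamma>R :: "real \<Rightarrow> real ^ 2"
  assumes "c1 > 0" "c2 \<ge> 0"
    and L: "continuous_on {-1..0} \<gamma>L" "(\<gamma>L has_vector_derivative a) (at 0 within {-1..0})"
    and R: "continuous_on {0..1} \<gamma>R" "(\<gamma>R has_vector_derivative b) (at 0 within {0..1})"
    and start: "\<gamma>L 0 = \<gamma>R 0"
    and disj: "scaled_boundary c1 c2 x0 \<gamma>L ` dom_L \<inter> scaled_boundary c1 c2 x0 \<gamma>R ` dom_R = {}"
  shows "det2 (\<gamma>R 0 - x0) a * det2 (\<gamma>R 0 - x0) b \<ge> 0"
proof (rule ccontr)
  let ?g = "\<gamma>R 0 - x0"
  let ?v = "\<lambda>t. \<gamma>L (- t) - x0" and ?w = "\<lambda>t. \<gamma>R t - x0"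
  assume "\<not> ?thesis"
  then have side: "det2 ?g (- a) * det2 ?g b > 0"
    by (simp add: det2_def algebra_simps)
  have v: "continuous_on {0..1} ?v"
    by (intro continuous_intros continuous_on_compose2[OF L(1)]) auto
  have "((\<lambda>t. - t) has_vector_derivative - 1) (at 0 within {0..1::real})"
    by (auto intro!: derivative_eq_intros)
  moreover have "uminus ` {0..1} = {-1..0::real}"
    by (simp add: image_uminus_atLeastAtMost)
  ultimately have "(\<gamma>L \<circ> uminus has_vector_derivative - 1 *\<^sub>R a) (at 0 within {0..1})"
    using L(2) by (intro vector_diff_chain_within) auto
  then have v': "(?v has_vector_derivative - a) (at 0 within {0..1})"
    by (auto intro!: derivative_eq_intros simp: o_def)
  have w: "continuous_on {0..1} ?w"
    by (intro continuous_intros R)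
  have w': "(?w has_vector_derivative b) (at 0 within {0..1})"
    using R(2) by (auto intro!: derivative_eq_intros)
  \<comment> \<open>The scaling factor at height 1/2, where the left point is taken. The tolerance
    \<open>c1 / (2 * h)\<close> for \<open>l\<close> is what keeps the height \<open>y\<close> of
    the right point strictly between 0 and 1.\<close>
  define h where "h = c1 / 2 + c2"
  have h: "h > 0"
    using assms by (simp add: h_def)
  have eps: "c1 / (2 * h) > 0"
    using h \<open>c1 > 0\<close> by simp
  obtain s t l where st: "s \<in> {0<..<1}" "t \<in> {0<..<1}" and l: "\<bar>l - 1\<bar> < c1 / (2 * h)"
    and vw: "?v s = l *\<^sub>R ?w t"
    by (rule curves_meet_common_ray[OF v v' w w' _ _ side eps]) (use start in auto)
  \<comment> \<open>The solution of \<open>c1 * y + c2 = h * l\<close>, written as a deviation from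
    1/2.\<close>
  define y where "y = 1 / 2 + h * (l - 1) / c1"
  have "\<bar>h * (l - 1) / c1\<bar> = h / c1 * \<bar>l - 1\<bar>"
    using h \<open>c1 > 0\<close> by (simp add: abs_mult)
  also have "\<dots> < h / c1 * (c1 / (2 * h))"
    using l h \<open>c1 > 0\<close> by (intro mult_strict_left_mono) auto
  finally have "\<bar>h * (l - 1) / c1\<bar> < 1 / 2"
    using h \<open>c1 > 0\<close> by simp
  then have y: "0 < y" "y < 1"
    unfolding y_def by linarith+
  have "c1 * y + c2 = h * l"
    using \<open>c1 > 0\<close> by (simp add: y_def h_def field_simps)
  then have "scaled_boundary c1 c2 x0 \<gamma>L (vector [- s, 1 / 2]) =
      scaled_boundary c1 c2 x0 \<gamma>R (vector [t, y])"
    using vw by (simp add: scaled_boundary_vector h_def)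
  moreover have "vector [- s, 1 / 2] \<in> dom_L" "vector [t, y] \<in> dom_R"
    using st y by (auto simp: dom_L_def dom_R_def)
  ultimately show False
    using disj by (metis IntI empty_iff imageI)
qed

section \<open>Construction of the gluing functions\<close>

theorem lemma3:
  fixes c1 c2 :: real and x0 :: "real ^ 2" and \<gamma>L \<gamma>R :: "real \<Rightarrow> real ^ 2"
  assumes "c1 > 0" and "c2 \<ge> 0"
    and "C1_on \<gamma>L {-1..0}" and "C1_on \<gamma>R {0..1}"
    and "\<gamma>L 0 = \<gamma>R 0"
    and "vector_derivative \<gamma>L (at 0 within {-1..0}) \<noteq> 0"
    and "vector_derivative \<gamma>R (at 0 within {0..1}) \<noteq> 0"
    and "\<And>\<delta>. 0 < \<delta> \<Longrightarrow> \<delta> < 1 \<Longrightarrow>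
           C1_diffeo_up_to_closure (scaled_boundary c1 c2 x0 \<gamma>L) (dom_L \<inter> {p. p $ 2 > \<delta>})"
    and "\<And>\<delta>. 0 < \<delta> \<Longrightarrow> \<delta> < 1 \<Longrightarrow>
           C1_diffeo_up_to_closure (scaled_boundary c1 c2 x0 \<gamma>R) (dom_R \<inter> {p. p $ 2 > \<delta>})"
    and "scaled_boundary c1 c2 x0 \<gamma>L ` dom_L \<inter> scaled_boundary c1 c2 x0 \<gamma>R ` dom_R = {}"
  shows "analysis_suitable_G1 (scaled_boundary c1 c2 x0 \<gamma>L) (scaled_boundary c1 c2 x0 \<gamma>R)"
proof -
  define g where "g = \<gamma>R 0 - x0"
  define a where "a = vector_derivative \<gamma>L (at 0 within {-1..0})"
  define b where "b = vector_derivative \<gamma>R (at 0 within {0..1})"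
  have L: "(\<gamma>L has_vector_derivative a) (at 0 within {-1..0})"
    unfolding a_def using assms(3) by (rule C1_on_has_vector_derivative) simp
  have R: "(\<gamma>R has_vector_derivative b) (at 0 within {0..1})"
    unfolding b_def using assms(4) by (rule C1_on_has_vector_derivative) simp
  \<comment> \<open>The choice \<delta> = 1/2 is arbitrary; regularity is evaluated at the interface
    point with \<zeta> = 0 and \<xi> = 1, which lies in the closed rectangle.\<close>
  have "dom_L \<inter> {p. p $ 2 > 1 / 2} =
      {p. -1 < p $ 1 \<and> p $ 1 < 0 \<and> 1 / 2 < p $ 2 \<and> p $ 2 < 1}"
    by (auto simp: dom_L_def)
  then have "closure (dom_L \<inter> {p. p $ 2 > 1 / 2}) =
      {p. -1 \<le> p $ 1 \<and> p $ 1 \<le> 0 \<and> 1 / 2 \<le> p $ 2 \<and> p $ 2 \<le> 1}"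
    using closure_open_rectangle[of "-1" 0 "1 / 2" 1] by simp
  from regular_scaled_boundary_det2_nonzero[OF assms(8) this, of 0 a]
  have detL: "det2 g a \<noteq> 0"
    using L assms(1,2,5) by (simp add: g_def)
  have "dom_R \<inter> {p. p $ 2 > 1 / 2} =
      {p. 0 < p $ 1 \<and> p $ 1 < 1 \<and> 1 / 2 < p $ 2 \<and> p $ 2 < 1}"
    by (auto simp: dom_R_def)
  then have "closure (dom_R \<inter> {p. p $ 2 > 1 / 2}) =
      {p. 0 \<le> p $ 1 \<and> p $ 1 \<le> 1 \<and> 1 / 2 \<le> p $ 2 \<and> p $ 2 \<le> 1}"
    using closure_open_rectangle[of 0 1 "1 / 2" 1] by simp
  from regular_scaled_boundary_det2_nonzero[OF assms(9) this, of 0 b]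
  have detR: "det2 g b \<noteq> 0"
    using R assms(1,2) by (simp add: g_def)
  have "det2 g a * det2 g b \<ge> 0"
    unfolding g_def
    using disjoint_patches_det2[OF assms(1,2) C1_on_imp_continuous_on[OF assms(3)] L
        C1_on_imp_continuous_on[OF assms(4)] R assms(5,10)] .
  then have pos: "det2 g a * det2 g b > 0"
    using detL detR by (simp add: less_le)
  have g: "g \<noteq> 0"
    using detR by (auto simp: det2_def)
  \<comment> \<open>The determinant of \<open>g\<close> with \<open>u\<close> cancels by
    bilinearity, so \<open>u\<close> is a multiple of \<open>g\<close>, and \<open>t\<close> is its
    projection coefficient.\<close>
  define u where "u = det2 g b *\<^sub>R a - det2 g a *\<^sub>R b"
  define t where "t = (g \<bullet> u) / (g \<bullet> g)"
  have "det2 g u = 0"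
    by (simp add: u_def det2_def algebra_simps)
  then have "(g \<bullet> g) *\<^sub>R u = (g \<bullet> g) *\<^sub>R (t *\<^sub>R g)"
    using det2_eq_0_imp_parallel[of g u] g by (simp add: t_def)
  then have "u = t *\<^sub>R g"
    using g by (simp only: scaleR_cancel_left) simp
  then have ut: "det2 g b *\<^sub>R a - det2 g a *\<^sub>R b = t *\<^sub>R g"
    by (simp add: u_def)
  \<comment> \<open>With the constants \<open>det2 g a\<close> and \<open>det2 g b\<close> as
    \<open>\<alpha>L\<close> and \<open>\<alpha>R\<close>, and zero as \<open>\<beta>R\<close>, the
    condition reduces to \<open>det2 g b * poly \<beta>L \<xi> * c1 = t * (c1 * \<xi> + c2)\<close>.
    The \<xi>-derivative \<open>c1 *\<^sub>R g\<close> is constant, so a linear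
    \<open>\<beta>L\<close> solves it.\<close>
  define k where "k = t / (c1 * det2 g b)"
  define \<beta>L where "\<beta>L = [:k * c2, k * c1:]"
  have deg: "degree \<beta>L \<le> 1"
    by (simp add: \<beta>L_def degree_pCons_eq_if)
  have balance: "det2 g b * poly \<beta>L \<xi> * c1 = t * (c1 * \<xi> + c2)" for \<xi>
    using detR assms(1) by (simp add: \<beta>L_def k_def field_simps)
  have dL: "vector_derivative (\<lambda>\<zeta>. scaled_boundary c1 c2 x0 \<gamma>L (vector [\<zeta>, \<xi>])) (at 0 within {-1..0}) =
      (c1 * \<xi> + c2) *\<^sub>R a" for \<xi>
    using vector_derivative_within_cbox[of "-1" 0 0, OF _ _ has_vector_derivative_scaled_boundary_fst] L
    by auto
  have dR: "vector_derivative (\<lambda>\<zeta>. scaled_boundary c1 c2 x0 \<gamma>R (vector [\<zeta>, \<xi>])) (at 0 within {0..1}) =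
      (c1 * \<xi> + c2) *\<^sub>R b" for \<xi>
    using vector_derivative_within_cbox[of 0 1 0, OF _ _ has_vector_derivative_scaled_boundary_fst] R
    by auto
  have dX: "vector_derivative (\<lambda>\<eta>. scaled_boundary c1 c2 x0 \<gamma>R (vector [0, \<eta>])) (at \<xi> within {0..1}) =
      c1 *\<^sub>R g" if "\<xi> \<in> {0..1}" for \<xi>
    using vector_derivative_within_cbox[of 0 1 \<xi>, OF _ _ has_vector_derivative_scaled_boundary_snd] that
    by (auto simp: g_def)
  have "det2 g b *\<^sub>R (c1 * \<xi> + c2) *\<^sub>R a - det2 g a *\<^sub>R (c1 * \<xi> + c2) *\<^sub>R b
      + (- (det2 g b * poly \<beta>L \<xi>)) *\<^sub>R c1 *\<^sub>R g = 0" for \<xi>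
  proof -
    have "det2 g b *\<^sub>R (c1 * \<xi> + c2) *\<^sub>R a - det2 g a *\<^sub>R (c1 * \<xi> + c2) *\<^sub>R b =
        (c1 * \<xi> + c2) *\<^sub>R (det2 g b *\<^sub>R a - det2 g a *\<^sub>R b)"
      by (simp only: scaleR_diff_right scaleR_scaleR mult.commute)
    then show ?thesis
      using balance[of \<xi>] by (simp add: ut mult.commute)
  qed
  then have "degree [:det2 g a:] \<le> 1 \<and> degree [:det2 g b:] \<le> 1 \<and> degree \<beta>L \<le> 1 \<and> degree (0 :: real poly) \<le> 1 \<and>
      (let \<beta> = [:det2 g a:] * 0 - [:det2 g b:] * \<beta>L in
        \<forall>\<xi>\<in>{0..1}.
          poly [:det2 g a:] \<xi> * poly [:det2 g b:] \<xi> > 0 \<and>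
          poly [:det2 g b:] \<xi> *\<^sub>R vector_derivative (\<lambda>\<zeta>. scaled_boundary c1 c2 x0 \<gamma>L (vector [\<zeta>, \<xi>])) (at 0 within {-1..0})
          - poly [:det2 g a:] \<xi> *\<^sub>R vector_derivative (\<lambda>\<zeta>. scaled_boundary c1 c2 x0 \<gamma>R (vector [\<zeta>, \<xi>])) (at 0 within {0..1})
          + poly \<beta> \<xi> *\<^sub>R vector_derivative (\<lambda>\<eta>. scaled_boundary c1 c2 x0 \<gamma>R (vector [0, \<eta>])) (at \<xi> within {0..1})
          = 0)"
    using pos deg by (simp add: dL dR dX)
  then show ?thesis
    unfolding analysis_suitable_G1_def by blast
qed

end
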